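(* Let $G$ be a connected block graph on at least two vertices, let $S$ be the set of its simplicial vertices, and let $W$ be a maximal clique of minimum cardinality in $G$. Then (i) $\mu^{-}_t(G)=|S|$, and (ii) $\mu^{-}(G)=|V(W)|$.
   Context: A block of $G$ is a maximal subgraph without a cut-vertex; $G$ is a block graph if every block is a complete graph. A vertex is simplicial if its neighborhood induces a complete graph. A maximal clique is a complete subgraph not contained in a larger one. For $X\subseteq V(G)$, two vertices $a,b$ are $X$-visible if there is a shortest $a,b$-path $P$ with $V(P)\cap X\subseteq\{a,b\}$. $X$ is a mutual-visibility set if every two vertices of $X$ are $X$-visible, and a total mutual-visibility set if every two vertices of $G$ are $X$-visible; such a set is maximal if no proper superset has the same property. $\mu^{-}(G)$ (resp. $\mu^{-}_t(G)$) is the minimum cardinality of a maximal mutual-visibility (resp. maximal total mutual-visibility) set. *)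

theory Defs
  imports "Graph_Theory.Graph_Theory"
begin

text \<open>
  A finite simple undirected graph is a symmetric digraph in the sense of the locale
  \<^locale>\<open>graph\<close>.  Accordingly, an undirected subgraph of such a graph is a \<^const>\<open>subgraph\<close>
  that is itself \<^const>\<open>symmetric\<close>, and its connected components are its strongly connected
  components.
\<close>

definition cut_vertex :: "('a, 'b) pre_digraph \<Rightarrow> 'a \<Rightarrow> bool" where
  "cut_vertex G v \<longleftrightarrow> v \<in> verts G \<and>
     card (pre_digraph.sccs G) < card (pre_digraph.sccs (pre_digraph.del_vert G v))"

text \<open>
  As usual, blocks are connected; without this requirement the two end edges of a path
  on four vertices would together form a block.
\<close>

definition block :: "('a, 'b) pre_digraph \<Rightarrow> ('a, 'b) pre_digraph \<Rightarrow> bool" where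
  "block G B \<longleftrightarrow>
     pre_digraph.max_subgraph G
       (\<lambda>H. symmetric H \<and> Digraph_Component.connected H \<and> (\<nexists>v. cut_vertex H v)) B"

definition complete_graph :: "('a, 'b) pre_digraph \<Rightarrow> bool" where
  "complete_graph G \<longleftrightarrow> complete_digraph (card (verts G)) G"

definition block_graph :: "('a, 'b) pre_digraph \<Rightarrow> bool" where
  "block_graph G \<longleftrightarrow> (\<forall>B. block G B \<longrightarrow> complete_graph B)"

definition neighborhood :: "('a, 'b) pre_digraph \<Rightarrow> 'a \<Rightarrow> 'a set" where
  "neighborhood G v = {u. v \<rightarrow>\<^bsub>G\<^esub> u}"

definition simplicial :: "('a, 'b) pre_digraph \<Rightarrow> 'a \<Rightarrow> bool" where
  "simplicial G v \<longleftrightarrow> v \<in> verts G \<and> complete_graph (G \<restriction> neighborhood G v)"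

definition maximal_clique :: "('a, 'b) pre_digraph \<Rightarrow> ('a, 'b) pre_digraph \<Rightarrow> bool" where
  "maximal_clique G W \<longleftrightarrow> pre_digraph.max_subgraph G complete_graph W"

definition shortest_path :: "('a, 'b) pre_digraph \<Rightarrow> 'a \<Rightarrow> 'b awalk \<Rightarrow> 'a \<Rightarrow> bool" where
  "shortest_path G a p b \<longleftrightarrow> pre_digraph.apath G a p b \<and>
     (\<forall>q. pre_digraph.apath G a q b \<longrightarrow> length p \<le> length q)"

definition visible :: "('a, 'b) pre_digraph \<Rightarrow> 'a set \<Rightarrow> 'a \<Rightarrow> 'a \<Rightarrow> bool" where
  "visible G X a b \<longleftrightarrow>
     (\<exists>p. shortest_path G a p b \<and> set (pre_digraph.awalk_verts G a p) \<inter> X \<subseteq> {a, b})"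

definition mutual_visibility_set :: "('a, 'b) pre_digraph \<Rightarrow> 'a set \<Rightarrow> bool" where
  "mutual_visibility_set G X \<longleftrightarrow> X \<subseteq> verts G \<and>
     (\<forall>a\<in>X. \<forall>b\<in>X. a \<noteq> b \<longrightarrow> visible G X a b)"

definition total_mutual_visibility_set :: "('a, 'b) pre_digraph \<Rightarrow> 'a set \<Rightarrow> bool" where
  "total_mutual_visibility_set G X \<longleftrightarrow> X \<subseteq> verts G \<and>
     (\<forall>a\<in>verts G. \<forall>b\<in>verts G. a \<noteq> b \<longrightarrow> visible G X a b)"

definition maximal_set :: "('a set \<Rightarrow> bool) \<Rightarrow> 'a set \<Rightarrow> bool" where
  "maximal_set P X \<longleftrightarrow> P X \<and> (\<forall>Y. X \<subset> Y \<longrightarrow> \<not> P Y)"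

text \<open>
  For a finite graph \<open>G\<close> the empty set is a mutual-visibility set, and if \<open>G\<close> is connected
  also a total one, so the minima below are then taken over finite nonempty sets.
\<close>

definition lower_mutual_visibility_number :: "('a, 'b) pre_digraph \<Rightarrow> nat" where
  "lower_mutual_visibility_number G =
     Min (card ` {X. maximal_set (mutual_visibility_set G) X})"

definition lower_total_mutual_visibility_number :: "('a, 'b) pre_digraph \<Rightarrow> nat" where
  "lower_total_mutual_visibility_number G =
     Min (card ` {X. maximal_set (total_mutual_visibility_set G) X})"

end

theory Submission
  imports Defs
begin

text \<open>
  A clique together with a path joining two of its vertices outside the clique has no cut vertex,
  so in a block graph it lies in a complete block. Hence geodesics are unique, and every vertex \<open>v\<close>
  has a gate in every maximal clique \<open>Q\<close>: a vertex of \<open>Q\<close> through which all geodesics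
  from \<open>v\<close> to \<open>Q\<close> pass.

  Uniqueness of geodesics makes \<open>X\<close>-visibility a betweenness condition. A vertex lies strictly
  between two others if and only if it is not simplicial, so the total mutual-visibility sets are
  exactly the sets of simplicial vertices. A maximal clique is a maximal mutual-visibility set,
  because any further vertex is hidden behind its gate. Conversely, if \<open>X\<close> is a maximal
  mutual-visibility set and \<open>Q\<close> a maximal clique containing an edge of a geodesic between two
  members of \<open>X\<close>, the gate map from \<open>X\<close> to \<open>Q\<close> is surjective.
\<close>

section \<open>Connectivity inside vertex sets\<close>

lemma dominates_induce_iff: "u \<rightarrow>\<^bsub>G \<restriction> T\<^esub> v \<longleftrightarrow> u \<rightarrow>\<^bsub>G\<^esub> v \<and> u \<in> T \<and> v \<in> T"
  by (auto simp: arcs_ends_conv)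

text \<open>Finiteness bounds the number of vertices plus arcs, so some extension of
  \<open>H\<close> with property \<open>P\<close> has the greatest count, and nothing properly
  contains it.\<close>

lemma (in fin_digraph) subgraph_extends_to_max_subgraph:
  assumes "subgraph H G" "P H"
  obtains B where "max_subgraph P B" "subgraph H B"
proof -
  let ?Q = "\<lambda>K. subgraph H K \<and> subgraph K G \<and> P K"
  let ?m = "\<lambda>K. card (verts K) + card (arcs K)"
  have "?Q H" using assms wf_digraph.subgraph_refl[of H] by auto
  moreover have "\<forall>K. ?Q K \<longrightarrow> ?m K < Suc (card (verts G) + card (arcs G))"
    by (auto simp: less_Suc_eq_le elim!: subgraphE intro!: add_mono card_mono)
  ultimately obtain B where B: "?Q B" and max: "\<And>K. ?Q K \<Longrightarrow> ?m K \<le> ?m B"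
    using ex_has_greatest_nat[of ?Q H ?m] by blast
  have "K = B" if K: "subgraph B K" "subgraph K G" "P K" for K
  proof -
    interpret K: fin_digraph K using K(2) by (rule fin_digraph_subgraph)
    have le: "?m K \<le> ?m B" using K B max subgraph_trans by blast
    have sub: "verts B \<subseteq> verts K" "arcs B \<subseteq> arcs K" using K(1) by auto
    then have "card (verts B) \<le> card (verts K)" "card (arcs B) \<le> card (arcs K)"
      by (auto intro: card_mono)
    with le have "card (verts B) = card (verts K)" "card (arcs B) = card (arcs K)" by auto
    then have "verts B = verts K" "arcs B = arcs K"
      using card_subset_eq[OF K.finite_verts sub(1)] card_subset_eq[OF K.finite_arcs sub(2)] by blast+
    \<comment> \<open>Compatibility makes the tail and head functions agree, so the two records
      coincide in every field.\<close>
    then show "K = B"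
      using K(1) by (intro pre_digraph.equality) (auto simp: subgraph_def compatible_def)
  qed
  then have "max_subgraph P B" using B by (auto intro: max_subgraphI)
  then show ?thesis using B that by blast
qed

lemma del_vert_induce: "pre_digraph.del_vert (G \<restriction> T) z = G \<restriction> (T - {z})"
  by (auto simp: pre_digraph.del_vert_def induce_subgraph_def)

context graph
begin

text \<open>A vertex-set version of completeness, which keeps arcs out of the combinatorial
  arguments; \<open>complete_graph_induce_iff\<close> and \<open>complete_subgraph_clique\<close>
  link it to complete subgraphs.\<close>

definition clique :: "'a set \<Rightarrow> bool" where
  "clique B \<longleftrightarrow> B \<subseteq> verts G \<and> (\<forall>x\<in>B. \<forall>y\<in>B. x \<noteq> y \<longrightarrow> x \<rightarrow>\<^bsub>G\<^esub> y)"

lemma adj_sym: "u \<rightarrow>\<^bsub>G\<^esub> v \<Longrightarrow> v \<rightarrow>\<^bsub>G\<^esub> u"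
  by (rule graph_symmetric)

lemma symmetric_induce: "symmetric (G \<restriction> T)"
  using adj_sym by (auto simp: symmetric_def sym_def dominates_induce_iff)

lemma reachable_induce_sym: "u \<rightarrow>\<^sup>*\<^bsub>G \<restriction> T\<^esub> v \<Longrightarrow> v \<rightarrow>\<^sup>*\<^bsub>G \<restriction> T\<^esub> u"
  using symmetric_induce by (rule symmetric_reachable)

lemma reachable_induce_trans:
  "u \<rightarrow>\<^sup>*\<^bsub>G \<restriction> T\<^esub> v \<Longrightarrow> v \<rightarrow>\<^sup>*\<^bsub>G \<restriction> T\<^esub> w \<Longrightarrow> u \<rightarrow>\<^sup>*\<^bsub>G \<restriction> T\<^esub> w"
  by (rule wf_digraph.reachable_trans) auto

lemma reachable_induce_refl: "u \<in> T \<Longrightarrow> u \<rightarrow>\<^sup>*\<^bsub>G \<restriction> T\<^esub> u"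
  by (rule wf_digraph.reachable_refl) auto

lemma reachable_induce_adjI: "u \<rightarrow>\<^bsub>G\<^esub> v \<Longrightarrow> u \<in> T \<Longrightarrow> v \<in> T \<Longrightarrow> u \<rightarrow>\<^sup>*\<^bsub>G \<restriction> T\<^esub> v"
  by (rule wf_digraph.reachable_adjI) (auto simp: dominates_induce_iff)

lemma reachable_induce_awalkI:
  assumes "awalk u p v" "set (awalk_verts u p) \<subseteq> T"
  shows "u \<rightarrow>\<^sup>*\<^bsub>G \<restriction> T\<^esub> v"
proof -
  interpret T: wf_digraph "G \<restriction> T" by auto
  show ?thesis using awalk_induce[OF assms] by (auto simp: T.reachable_awalk)
qed

lemma complete_graph_induce_iff:
  assumes "T \<subseteq> verts G"
  shows "complete_graph (G \<restriction> T) \<longleftrightarrow> clique T"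
proof -
  have "digraph (G \<restriction> T)"
    using assms by (intro digraph_subgraph subgraph_induce_subgraphI)
  then have "graph (G \<restriction> T)" using symmetric_induce by (rule digraph.graphI)
  moreover have "u \<noteq> v" if "u \<rightarrow>\<^bsub>G\<^esub> v" for u v using that adj_not_same by auto
  ultimately show ?thesis using assms
    by (auto simp: complete_graph_def complete_digraph_def clique_def set_eq_iff dominates_induce_iff)
qed

lemma complete_subgraph_clique:
  assumes "subgraph H G" "complete_graph H"
  shows "clique (verts H)"
proof -
  have "x \<rightarrow>\<^bsub>G\<^esub> y" if "x \<in> verts H" "y \<in> verts H" "x \<noteq> y" for x y
  proof -
    have "x \<rightarrow>\<^bsub>H\<^esub> y" using assms(2) that by (simp add: complete_graph_def complete_digraph_def)
    then show ?thesis using assms(1) by (rule adj_mono)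
  qed
  then show ?thesis using assms(1) by (auto simp: clique_def)
qed

section \<open>Sets without cut vertices in a block graph\<close>

text \<open>The induced subgraph is connected and has no cut vertex, so it extends to a block, and
  that block is complete.\<close>

lemma biconnected_set_clique:
  assumes bg: "block_graph G" and T: "T \<subseteq> verts G" "T \<noteq> {}"
    and conn: "\<And>x y. x \<in> T \<Longrightarrow> y \<in> T \<Longrightarrow> x \<rightarrow>\<^sup>*\<^bsub>G \<restriction> T\<^esub> y"
    and conn_del: "\<And>z x y. z \<in> T \<Longrightarrow> x \<in> T - {z} \<Longrightarrow> y \<in> T - {z} \<Longrightarrow> x \<rightarrow>\<^sup>*\<^bsub>G \<restriction> (T - {z})\<^esub> y"
  shows "clique T"
proof -
  let ?H = "G \<restriction> T"
  let ?P = "\<lambda>H. symmetric H \<and> Digraph_Component.connected H \<and> (\<nexists>v. cut_vertex H v)"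
  interpret H: wf_digraph ?H by auto
  have sub: "subgraph ?H G" using T by (intro subgraph_induce_subgraphI)
  have "strongly_connected ?H" using T conn by auto
  then have sccs: "card H.sccs = 1" by (simp add: H.strongly_connected_eq_iff)
  have "\<not> cut_vertex ?H z" for z
  proof
    assume cut: "cut_vertex ?H z"
    let ?K = "G \<restriction> (T - {z})"
    interpret K: wf_digraph ?K by auto
    have zT: "z \<in> T" and lt: "1 < card K.sccs"
      using cut sccs by (auto simp: cut_vertex_def del_vert_induce)
    show False
    proof (cases "T = {z}")
      case True
      \<comment> \<open>Components are nonempty, so deleting the only vertex leaves none, and their
        number drops instead of growing.\<close>
      then have "K.sccs = {}"
        by (auto simp: pre_digraph.sccs_def induced_subgraph_def subgraph_def strongly_connected_def)
      then show False using lt by simp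
    next
      case False
      then have "strongly_connected ?K"
        using zT by (intro strongly_connectedI) (auto intro: conn_del)
      then show False using lt by (simp add: K.strongly_connected_eq_iff)
    qed
  qed
  moreover have "Digraph_Component.connected ?H"
    using T conn by (intro H.connectedI) (auto simp: H.reachable_mk_symmetric_eq symmetric_induce)
  ultimately have "?P ?H" using symmetric_induce by blast
  then obtain B where B: "max_subgraph ?P B" "subgraph ?H B"
    by (rule subgraph_extends_to_max_subgraph[OF sub])
  then have "complete_graph B" using bg by (auto simp: block_graph_def block_def)
  then have "clique (verts B)" using B(1) by (intro complete_subgraph_clique) (rule subgraphI_max_subgraph)
  moreover have "T \<subseteq> verts B" using subgraph_imp_subverts[OF B(2)] by simp
  ultimately show ?thesis unfolding clique_def by blast
qed

text \<open>A path from \<open>r1\<close> to \<open>r2\<close> outside \<open>B\<close>, closed up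
  by the edges to \<open>g1\<close> and \<open>g2\<close>, forms an ear on \<open>B\<close>. No
  single vertex disconnects the clique together with its ear, so the union is again a clique and
  \<open>r1\<close> is adjacent to all of \<open>B\<close>.\<close>

lemma clique_ear:
  assumes bg: "block_graph G" and B: "clique B" and g: "g1 \<in> B" "g2 \<in> B" "g1 \<noteq> g2"
    and r: "r1 \<rightarrow>\<^sup>*\<^bsub>G \<restriction> (verts G - B)\<^esub> r2" and adj: "r1 \<rightarrow>\<^bsub>G\<^esub> g1" "r2 \<rightarrow>\<^bsub>G\<^esub> g2"
    and q: "q \<in> B"
  shows "r1 \<rightarrow>\<^bsub>G\<^esub> q"
proof -
  let ?R = "verts G - B"
  interpret R: wf_digraph "G \<restriction> ?R" by auto
  obtain p where p: "R.apath r1 p r2" using r by (auto simp: R.reachable_apath)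
  then have ap: "apath r1 p r2"
    by (rule subgraph_apath_imp_apath) (auto intro: subgraph_induce_subgraphI)
  define P where "P = set (awalk_verts r1 p)"
  define T where "T = B \<union> P"
  have PR: "P \<subseteq> ?R" using p by (auto simp: P_def R.apath_def R.awalk_conv awalk_verts_induce)
  have ends: "r1 \<in> P" "r2 \<in> P"
    using ap by (auto simp: P_def apath_def hd_in_awalk_verts)
  have TV: "T \<subseteq> verts G" using PR B by (auto simp: T_def clique_def)
  \<comment> \<open>The path does not repeat vertices, so \<open>z\<close> lies on at most one side
    of \<open>x\<close>; the other side still leads to an end of the path.\<close>
  have split: "(x \<rightarrow>\<^sup>*\<^bsub>G \<restriction> (P - {z})\<^esub> r1 \<or> x \<rightarrow>\<^sup>*\<^bsub>G \<restriction> (P - {z})\<^esub> r2)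
      \<and> (z \<notin> P \<longrightarrow> x \<rightarrow>\<^sup>*\<^bsub>G \<restriction> (P - {z})\<^esub> r1 \<and> x \<rightarrow>\<^sup>*\<^bsub>G \<restriction> (P - {z})\<^esub> r2)"
    if x: "x \<in> P" "x \<noteq> z" for x z
  proof -
    obtain s t where st: "p = s @ t" "awalk r1 s x" "awalk x t r2"
      using awalk_decomp[of r1 p r2 x] ap x by (auto simp: apath_def P_def)
    have P: "P = set (awalk_verts r1 s) \<union> set (awalk_verts x t)"
      unfolding P_def st(1) using st by (intro set_awalk_verts_append)
    have "z \<notin> set (awalk_verts r1 s) \<or> z \<notin> set (awalk_verts x t)"
    proof (rule ccontr)
      assume "\<not> ?thesis"
      moreover have "awlast r1 s = x" using st by auto
      moreover have "awalk_verts x t = x # tl (awalk_verts x t)"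
        using st(3) by (metis awhd_of_awalk awalk_verts_non_Nil list.collapse)
      then have "z \<in> set (awalk_verts x t) \<Longrightarrow> z \<in> set (tl (awalk_verts x t))"
        using x(2) by (metis set_ConsD)
      ultimately show False using apath_decomp_disjoint[OF ap st(1), of z] by auto
    qed
    moreover have "z \<notin> set (awalk_verts r1 s) \<Longrightarrow> x \<rightarrow>\<^sup>*\<^bsub>G \<restriction> (P - {z})\<^esub> r1"
      using st P by (intro reachable_induce_sym[OF reachable_induce_awalkI]) auto
    moreover have "z \<notin> set (awalk_verts x t) \<Longrightarrow> x \<rightarrow>\<^sup>*\<^bsub>G \<restriction> (P - {z})\<^esub> r2"
      using st P by (intro reachable_induce_awalkI) auto
    ultimately show ?thesis using P by blast
  qed
  have to_B: "\<exists>b\<in>B - {z}. x \<rightarrow>\<^sup>*\<^bsub>G \<restriction> (T - {z})\<^esub> b" if x: "x \<in> T" "x \<noteq> z" for x z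
  proof (cases "x \<in> B")
    case True
    then show ?thesis using x by (intro bexI[of _ x]) (auto intro: reachable_induce_refl)
  next
    case False
    then have xP: "x \<in> P" using x by (auto simp: T_def)
    have sub: "P - {z} \<subseteq> T - {z}" by (auto simp: T_def)
    have via: "\<exists>b\<in>B - {z}. x \<rightarrow>\<^sup>*\<^bsub>G \<restriction> (T - {z})\<^esub> b"
      if "x \<rightarrow>\<^sup>*\<^bsub>G \<restriction> (P - {z})\<^esub> w" "w \<rightarrow>\<^bsub>G\<^esub> b" "b \<in> B" "b \<noteq> z" for w b
    proof -
      have "w \<in> P - {z}" using that(1) by (auto elim: reachable_in_vertsE)
      then have "w \<rightarrow>\<^sup>*\<^bsub>G \<restriction> (T - {z})\<^esub> b"
        using that by (intro reachable_induce_adjI) (auto simp: T_def)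
      then show ?thesis
        using that reachable_induce_trans[OF reachable_induce_ss[OF that(1) sub]] by blast
    qed
    \<comment> \<open>A deleted \<open>z\<close> on the path leaves both \<open>g1\<close> and
      \<open>g2\<close>, so the surviving side suffices. Otherwise both ends are reachable and
      \<open>z\<close> equals at most one of \<open>g1\<close> and \<open>g2\<close>.\<close>
    show ?thesis
    proof (cases "z \<in> P")
      case True
      then have "g1 \<noteq> z" "g2 \<noteq> z" using g PR by auto
      then show ?thesis using split[OF xP x(2)] via adj g by blast
    next
      case False
      then show ?thesis using split[OF xP x(2)] via adj g by blast
    qed
  qed
  have conn: "x \<rightarrow>\<^sup>*\<^bsub>G \<restriction> (T - {z})\<^esub> y" if "x \<in> T - {z}" "y \<in> T - {z}" for x y z
  proof -
    obtain b c where bc: "b \<in> B - {z}" "x \<rightarrow>\<^sup>*\<^bsub>G \<restriction> (T - {z})\<^esub> b"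
      "c \<in> B - {z}" "y \<rightarrow>\<^sup>*\<^bsub>G \<restriction> (T - {z})\<^esub> c"
      using to_B \<open>x \<in> T - {z}\<close> \<open>y \<in> T - {z}\<close> by (metis Diff_iff insertI1)
    have "b \<rightarrow>\<^sup>*\<^bsub>G \<restriction> (T - {z})\<^esub> c"
      using B bc by (cases "b = c")
        (auto simp: clique_def T_def intro: reachable_induce_adjI reachable_induce_refl)
    then show ?thesis using bc reachable_induce_sym reachable_induce_trans by blast
  qed
  \<comment> \<open>Connectivity of \<open>T\<close> is inherited from \<open>T - {z}\<close> for a
    third vertex \<open>z\<close>, which exists because \<open>g1\<close>, \<open>g2\<close> and
    \<open>r1\<close> are distinct.\<close>
  have "x \<rightarrow>\<^sup>*\<^bsub>G \<restriction> T\<^esub> y" if "x \<in> T" "y \<in> T" for x y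
  proof (cases "\<exists>z\<in>T. x \<noteq> z \<and> y \<noteq> z")
    case True
    then obtain z where "z \<in> T" "x \<noteq> z" "y \<noteq> z" by blast
    then have "x \<rightarrow>\<^sup>*\<^bsub>G \<restriction> (T - {z})\<^esub> y" using conn that by blast
    then show ?thesis by (rule reachable_induce_ss) auto
  next
    case False
    have "g1 \<in> T" "g2 \<in> T" "r1 \<in> T" "r1 \<noteq> g1" "r1 \<noteq> g2"
      using g ends PR by (auto simp: T_def)
    with False g(3) show ?thesis by metis
  qed
  then have "clique T" using bg TV g conn by (intro biconnected_set_clique) (auto simp: T_def)
  moreover have "r1 \<noteq> q" using q ends PR by auto
  ultimately show ?thesis using q ends by (auto simp: clique_def T_def)
qed

end

section \<open>Distances\<close>

locale connected_graph = graph +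
  assumes connected: "Digraph_Component.connected G"
begin

text \<open>The graph distance, taken as a natural number so that betweenness becomes linear
  arithmetic. It is the length of an actual walk for any two vertices, by connectedness.\<close>

definition gdist :: "'a \<Rightarrow> 'a \<Rightarrow> nat" where
  "gdist u v = (LEAST n. (u, v) \<in> arcs_ends G ^^ n)"

lemma gdist_attained:
  assumes "u \<in> verts G" "v \<in> verts G"
  shows "(u, v) \<in> arcs_ends G ^^ gdist u v"
proof -
  have "u \<rightarrow>\<^sup>*\<^bsub>G\<^esub> v"
    using symmetric_connected_imp_strongly_connected[OF sym_arcs connected] assms
    unfolding strongly_connected_def by blast
  then have "\<exists>n. (u, v) \<in> arcs_ends G ^^ n"
    unfolding rtrancl_power[symmetric] by (rule reachable_rtranclI)
  then show ?thesis unfolding gdist_def by (rule LeastI_ex)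
qed

lemma gdist_le: "(u, v) \<in> arcs_ends G ^^ n \<Longrightarrow> gdist u v \<le> n"
  unfolding gdist_def by (rule Least_le)

lemma gdist_refl [simp]: "gdist u u = 0"
  using gdist_le[of u u 0] by simp

lemma gdist_eq_0_iff:
  assumes "u \<in> verts G" "v \<in> verts G"
  shows "gdist u v = 0 \<longleftrightarrow> u = v"
proof
  assume "gdist u v = 0"
  then show "u = v" using gdist_attained[OF assms] by simp
qed simp

lemma gdist_triangle:
  assumes "u \<in> verts G" "v \<in> verts G" "w \<in> verts G"
  shows "gdist u w \<le> gdist u v + gdist v w"
proof (rule gdist_le)
  show "(u, w) \<in> arcs_ends G ^^ (gdist u v + gdist v w)"
    unfolding relpow_add
    using gdist_attained[OF assms(1,2)] gdist_attained[OF assms(2,3)] by (rule relcompI)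
qed

lemma relpow_arcs_ends_sym: "(u, v) \<in> arcs_ends G ^^ n \<Longrightarrow> (v, u) \<in> arcs_ends G ^^ n"
proof (induction n arbitrary: v)
  case (Suc n)
  from Suc.prems obtain w where w: "(u, w) \<in> arcs_ends G ^^ n" "w \<rightarrow>\<^bsub>G\<^esub> v" by (rule relpow_Suc_E)
  show ?case using adj_sym[OF w(2)] Suc.IH[OF w(1)] by (rule relpow_Suc_I2)
qed simp

lemma gdist_sym: "gdist u v = gdist v u"
proof -
  have "(u, v) \<in> arcs_ends G ^^ n \<longleftrightarrow> (v, u) \<in> arcs_ends G ^^ n" for n
    using relpow_arcs_ends_sym by blast
  then show ?thesis by (simp add: gdist_def)
qed

lemma gdist_eq_1_iff:
  assumes "u \<in> verts G" "v \<in> verts G"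
  shows "gdist u v = 1 \<longleftrightarrow> u \<rightarrow>\<^bsub>G\<^esub> v"
proof
  assume "gdist u v = 1"
  then show "u \<rightarrow>\<^bsub>G\<^esub> v" using gdist_attained[OF assms] by auto
next
  assume uv: "u \<rightarrow>\<^bsub>G\<^esub> v"
  then have "gdist u v \<le> 1" by (intro gdist_le) auto
  moreover have "gdist u v \<noteq> 0" using uv adj_not_same by (auto simp: gdist_eq_0_iff[OF assms])
  ultimately show "gdist u v = 1" by simp
qed

lemma gdist_adj: "u \<rightarrow>\<^bsub>G\<^esub> v \<Longrightarrow> gdist u v = 1"
  using gdist_eq_1_iff adj_in_verts by blast

text \<open>The vertex \<open>z\<close> is the last one before \<open>u\<close> on a geodesic from
  \<open>a\<close>; this drives the inductions on distance.\<close>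

lemma gdist_parent:
  assumes "a \<in> verts G" "u \<in> verts G" "gdist a u = Suc k"
  obtains z where "z \<in> verts G" "z \<rightarrow>\<^bsub>G\<^esub> u" "gdist a z = k"
proof -
  obtain z where z: "(a, z) \<in> arcs_ends G ^^ k" "z \<rightarrow>\<^bsub>G\<^esub> u"
    using gdist_attained[OF assms(1,2)] assms(3) by auto
  then have zV: "z \<in> verts G" by (auto dest: adj_in_verts)
  have "Suc k \<le> gdist a z + 1"
    using gdist_triangle[OF assms(1) zV assms(2)] assms(3) gdist_adj[OF z(2)] by simp
  then have "gdist a z = k" using gdist_le[OF z(1)] by simp
  then show ?thesis using z zV that by blast
qed

text \<open>If \<open>B\<close> contains no vertex between \<open>x\<close> and \<open>y\<close>, a
  geodesic is a path avoiding \<open>B\<close>. This turns distance equations into the reachability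
  that \<open>clique_ear\<close> asks for.\<close>

lemma reachable_avoiding:
  assumes "x \<in> verts G" "y \<in> verts G"
    and "\<And>w. w \<in> B \<Longrightarrow> w \<in> verts G \<Longrightarrow> gdist x w + gdist w y \<noteq> gdist x y"
  shows "x \<rightarrow>\<^sup>*\<^bsub>G \<restriction> (verts G - B)\<^esub> y"
  using assms
proof (induction "gdist x y" arbitrary: y)
  case 0
  then have "x = y" by (simp add: gdist_eq_0_iff)
  moreover have "y \<notin> B" using 0 \<open>x = y\<close> by fastforce
  ultimately show ?case using 0 by (auto intro: reachable_induce_refl)
next
  case (Suc n)
  then obtain u where u: "u \<in> verts G" "u \<rightarrow>\<^bsub>G\<^esub> y" "gdist x u = n" using gdist_parent by (metis Suc.hyps(2))
  \<comment> \<open>A vertex between \<open>x\<close> and the penultimate vertex \<open>u\<close>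
    would also be between \<open>x\<close> and \<open>y\<close>.\<close>
  have avoid: "gdist x w + gdist w u \<noteq> gdist x u" if w: "w \<in> B" "w \<in> verts G" for w
  proof
    assume "gdist x w + gdist w u = gdist x u"
    moreover have "gdist w y \<le> gdist w u + 1"
      using gdist_triangle[OF w(2) u(1) Suc.prems(2)] gdist_adj[OF u(2)] by simp
    moreover have "gdist x y \<le> gdist x w + gdist w y"
      using gdist_triangle w Suc.prems by blast
    ultimately show False using Suc.prems(3)[OF w] u(3) Suc.hyps(2) by simp
  qed
  then have "x \<rightarrow>\<^sup>*\<^bsub>G \<restriction> (verts G - B)\<^esub> u" using Suc.hyps(1) u Suc.prems by blast
  moreover have "u \<notin> B" "y \<notin> B" using avoid[of u] Suc.prems(3)[of y] Suc.prems(2) u by auto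
  then have "u \<rightarrow>\<^sup>*\<^bsub>G \<restriction> (verts G - B)\<^esub> y" using u Suc.prems by (intro reachable_induce_adjI) auto
  ultimately show ?case by (rule reachable_induce_trans)
qed

section \<open>Shortest walks and shortest paths\<close>

lemma gdist_le_awalk: "awalk u p v \<Longrightarrow> gdist u v \<le> length p"
proof (rule gdist_le, induction p arbitrary: u)
  case Nil
  then show ?case by (auto simp: awalk_Nil_iff)
next
  case (Cons e p)
  then have "u \<rightarrow>\<^bsub>G\<^esub> head G e" "(head G e, v) \<in> arcs_ends G ^^ length p"
    by (auto simp: awalk_Cons_iff arcs_ends_conv)
  then show ?case by (metis length_Cons relpow_Suc_I2)
qed

lemma awalk_of_gdist:
  assumes "u \<in> verts G" "v \<in> verts G"
  obtains p where "awalk u p v" "length p = gdist u v"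
proof -
  have "\<exists>p. awalk u p v \<and> length p = n" if "(u, v) \<in> arcs_ends G ^^ n" "u \<in> verts G" for n u
    using that
  proof (induction n arbitrary: u)
    case 0
    then show ?case by (auto simp: awalk_Nil_iff)
  next
    case (Suc n)
    then obtain w where w: "u \<rightarrow>\<^bsub>G\<^esub> w" "(w, v) \<in> arcs_ends G ^^ n" by (blast dest: relpow_Suc_D2)
    then obtain p where "awalk w p v" "length p = n" using Suc.IH adj_in_verts by blast
    moreover obtain e where "e \<in> arcs G" "tail G e = u" "head G e = w" using w(1) by blast
    ultimately show ?case by (intro exI[of _ "e # p"]) (auto simp: awalk_Cons_iff)
  qed
  then show ?thesis using gdist_attained[OF assms] assms that by blast
qed

text \<open>A repeated vertex would enclose a closed part of the walk, and cutting it out would beat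
  the distance.\<close>

lemma shortest_awalk_apath:
  assumes p: "awalk u p v" and len: "length p = gdist u v"
  shows "apath u p v"
proof -
  have "distinct (awalk_verts u p)"
  proof (rule ccontr)
    assume "\<not> distinct (awalk_verts u p)"
    then obtain q r s w where d: "p = q @ r @ s" "0 < length r" "awalk u q w" "awalk w s v"
      using awalk_not_distinct_decomp[OF p] by blast
    then have "awalk u (q @ s) v" by (intro awalk_appendI)
    then show False using gdist_le_awalk[of u "q @ s" v] d len by (simp del: length_greater_0_conv)
  qed
  then show ?thesis using p by (simp add: apath_def)
qed

text \<open>Minimality among paths agrees with minimality among walks, since a walk of length
  \<open>gdist u v\<close> is already a path.\<close>

lemma shortest_path_iff: "shortest_path G u p v \<longleftrightarrow> awalk u p v \<and> length p = gdist u v"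
proof
  assume sp: "shortest_path G u p v"
  then have p: "awalk u p v" by (auto simp: shortest_path_def apath_def)
  then have "u \<in> verts G" "v \<in> verts G" by auto
  then obtain q where "awalk u q v" "length q = gdist u v" by (rule awalk_of_gdist)
  then have "length p \<le> gdist u v"
    using sp shortest_awalk_apath unfolding shortest_path_def by metis
  then show "awalk u p v \<and> length p = gdist u v" using p gdist_le_awalk[OF p] by simp
next
  assume p: "awalk u p v \<and> length p = gdist u v"
  then have "apath u p v" using shortest_awalk_apath by simp
  then show "shortest_path G u p v"
    using p gdist_le_awalk awalkI_apath by (simp add: shortest_path_def)
qed

lemma shortest_path_exists:
  assumes "u \<in> verts G" "v \<in> verts G"
  obtains p where "shortest_path G u p v"
  by (rule awalk_of_gdist[OF assms], rule that) (simp add: shortest_path_iff)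

lemma shortest_path_between:
  assumes sp: "shortest_path G a p b" and x: "x \<in> set (awalk_verts a p)"
  shows "x \<in> verts G" "gdist a x + gdist x b = gdist a b"
proof -
  have p: "awalk a p b" "length p = gdist a b" using sp by (auto simp: shortest_path_iff)
  obtain q r where qr: "p = q @ r" "awalk a q x" "awalk x r b"
    using awalk_decomp[OF p(1) x] by blast
  show xV: "x \<in> verts G" using qr by auto
  have "gdist a x + gdist x b \<le> gdist a b"
    using gdist_le_awalk[OF qr(2)] gdist_le_awalk[OF qr(3)] p(2) qr(1) by simp
  moreover have "a \<in> verts G" "b \<in> verts G" using p by auto
  ultimately show "gdist a x + gdist x b = gdist a b" using gdist_triangle[of a x b] xV by simp
qed

end

section \<open>Geodesics and gates in block graphs\<close>

locale connected_block_graph = connected_graph +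
  assumes block_graph: "block_graph G"
begin

text \<open>This is uniqueness of geodesics in local form. If \<open>y\<close> and \<open>y'\<close>
  differed, the predecessor \<open>z\<close> of \<open>y\<close> towards \<open>b\<close> would be
  joined to \<open>y'\<close> outside the edge \<open>{u, y}\<close>. The resulting ear makes
  \<open>z\<close> adjacent to \<open>u\<close>, although their distances to \<open>b\<close> differ
  by two.\<close>

lemma gdist_parent_unique:
  assumes b: "b \<in> verts G" and adj: "u \<rightarrow>\<^bsub>G\<^esub> y" "u \<rightarrow>\<^bsub>G\<^esub> y'"
    and d: "gdist b u = Suc (gdist b y)" "gdist b u = Suc (gdist b y')"
  shows "y = y'"
proof (rule ccontr)
  assume ne: "y \<noteq> y'"
  have V: "u \<in> verts G" "y \<in> verts G" "y' \<in> verts G" using adj by (auto dest: adj_in_verts)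
  have uy: "u \<noteq> y" "u \<noteq> y'" using adj adj_not_same by auto
  have "gdist b y \<noteq> 0" using d ne by (metis Suc_inject b gdist_eq_0_iff V)
  then obtain k where k: "gdist b y = Suc k" by (metis not0_implies_Suc)
  then obtain z where z: "z \<in> verts G" "z \<rightarrow>\<^bsub>G\<^esub> y" "gdist b z = k" using gdist_parent b V by metis
  have "y' \<noteq> y" "gdist y y' \<noteq> 0" using ne V by (auto simp: gdist_eq_0_iff)
  \<comment> \<open>From \<open>b\<close>, the vertex \<open>u\<close> is too far and
    \<open>y\<close> just as far as \<open>y'\<close>, so neither is between; the same comparison
    works for \<open>z\<close>.\<close>
  have "b \<rightarrow>\<^sup>*\<^bsub>G \<restriction> (verts G - {u, y})\<^esub> y'"
    using b V d \<open>gdist y y' \<noteq> 0\<close> by (intro reachable_avoiding) auto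
  moreover have "b \<rightarrow>\<^sup>*\<^bsub>G \<restriction> (verts G - {u, y})\<^esub> z"
    using b z d k by (intro reachable_avoiding) auto
  ultimately have "z \<rightarrow>\<^sup>*\<^bsub>G \<restriction> (verts G - {u, y})\<^esub> y'"
    using reachable_induce_sym reachable_induce_trans by blast
  moreover have "clique {u, y}" using V adj adj_sym by (auto simp: clique_def)
  \<comment> \<open>The ear starts at \<open>y\<close> through \<open>z\<close> and returns to
    \<open>u\<close> through \<open>y'\<close>.\<close>
  ultimately have "z \<rightarrow>\<^bsub>G\<^esub> u"
    using clique_ear[OF block_graph, of "{u, y}" y u z y' u] z adj adj_sym uy by auto
  then have "gdist b u \<le> gdist b z + 1"
    using gdist_triangle[OF b z(1) V(1)] gdist_adj by simp
  then show False using d k z by simp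
qed

text \<open>Every vertex between \<open>a\<close> and \<open>b\<close> lies on the given path,
  whichever shortest path it is. The first step from \<open>a\<close> towards \<open>x\<close> also
  approaches \<open>b\<close>, so uniqueness makes it the first step of the path.\<close>

lemma between_on_shortest_path:
  assumes "shortest_path G a p b" "x \<in> verts G" "gdist a x + gdist x b = gdist a b"
  shows "x \<in> set (awalk_verts a p)"
  using assms unfolding shortest_path_iff
proof (induction p arbitrary: a)
  case Nil
  then show ?case by (auto simp: awalk_Nil_iff gdist_eq_0_iff)
next
  case (Cons e p)
  let ?h = "head G e"
  have e: "e \<in> arcs G" "tail G e = a" "awalk ?h p b"
    using Cons.prems by (auto simp: awalk_Cons_iff)
  then have V: "a \<in> verts G" "?h \<in> verts G" "b \<in> verts G" by auto
  have ah: "a \<rightarrow>\<^bsub>G\<^esub> ?h" using e by (auto simp: arcs_ends_conv)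
  have "gdist a b \<le> 1 + gdist ?h b" using gdist_triangle[of a ?h b] V gdist_adj[OF ah] by simp
  then have len: "length p = gdist ?h b" "gdist a b = Suc (gdist ?h b)"
    using Cons.prems gdist_le_awalk[OF e(3)] by auto
  show ?case
  proof (cases "x = a")
    case True
    then show ?thesis using e by simp
  next
    case False
    then obtain k where k: "gdist x a = Suc k"
      using V Cons.prems(2) by (metis gdist_eq_0_iff not0_implies_Suc)
    \<comment> \<open>Distances are read from \<open>x\<close>, so the parent of \<open>a\<close> is
      the first vertex after \<open>a\<close> on the way to \<open>x\<close>.\<close>
    then obtain a' where a': "a' \<in> verts G" "a' \<rightarrow>\<^bsub>G\<^esub> a" "gdist x a' = k"
      using gdist_parent V Cons.prems(2) by metis
    have "gdist a b \<le> 1 + gdist a' b"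
      using gdist_triangle[of a a' b] V a' gdist_adj[OF adj_sym[OF a'(2)]] by simp
    moreover have "gdist a' b \<le> k + gdist x b"
      using gdist_triangle[of a' x b] V a' Cons.prems(2) by (simp add: gdist_sym)
    moreover have "gdist a b = Suc k + gdist x b"
      using Cons.prems(3) k by (simp add: gdist_sym)
    ultimately have a'b: "gdist a' b = k + gdist x b" "gdist a b = Suc (gdist a' b)" by auto
    then have "a' = ?h"
      using gdist_parent_unique[of b a a' ?h] V ah adj_sym[OF a'(2)] len by (simp add: gdist_sym)
    then have "gdist ?h x + gdist x b = gdist ?h b" using a'(3) a'b by (simp add: gdist_sym)
    then show ?thesis using Cons.IH[of ?h] e len Cons.prems(2) by simp
  qed
qed

text \<open>With all shortest paths passing through the same vertices, the choice of path disappears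
  and only a condition on distances remains.\<close>

lemma visible_iff:
  assumes "a \<in> verts G" "b \<in> verts G" "X \<subseteq> verts G"
  shows "visible G X a b \<longleftrightarrow>
    (\<forall>x\<in>X. gdist a x + gdist x b = gdist a b \<longrightarrow> x = a \<or> x = b)" (is "?L \<longleftrightarrow> ?R")
proof
  assume ?L
  then show ?R using assms(3) between_on_shortest_path unfolding visible_def by blast
next
  assume ?R
  moreover obtain p where "shortest_path G a p b" using assms(1,2) by (rule shortest_path_exists)
  ultimately show ?L using shortest_path_between unfolding visible_def by blast
qed

section \<open>Maximal cliques and their gates\<close>

text \<open>Maximality is tested one vertex at a time, which suffices because subsets of cliques are
  cliques.\<close>

definition max_clique :: "'a set \<Rightarrow> bool" where
  "max_clique Q \<longleftrightarrow> clique Q \<and> (\<forall>v\<in>verts G - Q. \<exists>q\<in>Q. \<not> v \<rightarrow>\<^bsub>G\<^esub> q)"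

text \<open>Each component of the graph outside \<open>Q\<close> attaches to at most one vertex of
  \<open>Q\<close>: a second attachment would yield an ear making \<open>r1\<close> adjacent to all
  of \<open>Q\<close>, against maximality.\<close>

lemma max_clique_attachment_unique:
  assumes Q: "max_clique Q" and r: "r1 \<rightarrow>\<^sup>*\<^bsub>G \<restriction> (verts G - Q)\<^esub> r2"
    and g: "g1 \<in> Q" "g2 \<in> Q" "r1 \<rightarrow>\<^bsub>G\<^esub> g1" "r2 \<rightarrow>\<^bsub>G\<^esub> g2"
  shows "g1 = g2"
proof (rule ccontr)
  assume "g1 \<noteq> g2"
  moreover have "clique Q" using Q by (simp add: max_clique_def)
  ultimately have "\<forall>q\<in>Q. r1 \<rightarrow>\<^bsub>G\<^esub> q"
    using clique_ear[OF block_graph _ g(1,2) _ r g(3,4)] by blast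
  moreover have "r1 \<in> verts G - Q" using r by (auto elim: reachable_in_vertsE)
  ultimately show False using Q by (auto simp: max_clique_def)
qed

text \<open>The gate of metric graph theory, specialised to a clique, where leaving the gate for
  another vertex of \<open>Q\<close> costs exactly one step. A vertex of \<open>Q\<close> is its own
  gate.\<close>

definition is_gate :: "'a set \<Rightarrow> 'a \<Rightarrow> 'a \<Rightarrow> bool" where
  "is_gate Q v g \<longleftrightarrow> g \<in> Q \<and> (\<forall>q\<in>Q. q \<noteq> g \<longrightarrow> gdist v q = Suc (gdist v g))"

text \<open>The predecessor \<open>z\<close> of \<open>g\<close> on a geodesic from \<open>v\<close>
  is closer to \<open>v\<close> than all of \<open>Q\<close>, so the way to \<open>z\<close> avoids
  \<open>Q\<close>. The vertex \<open>g\<close> need not be the only nearest one, so two tied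
  candidates can be compared.\<close>

lemma nearest_attachment:
  assumes v: "v \<in> verts G - Q" and g: "g \<in> Q" "g \<in> verts G"
    and min: "\<And>q. q \<in> Q \<Longrightarrow> gdist v g \<le> gdist v q"
  obtains z where "v \<rightarrow>\<^sup>*\<^bsub>G \<restriction> (verts G - Q)\<^esub> z" "z \<rightarrow>\<^bsub>G\<^esub> g"
proof -
  have "v \<noteq> g" using v g(1) by blast
  then have "gdist v g \<noteq> 0" using v g(2) by (simp add: gdist_eq_0_iff)
  then obtain k where k: "gdist v g = Suc k" using not0_implies_Suc by blast
  then obtain z where z: "z \<in> verts G" "z \<rightarrow>\<^bsub>G\<^esub> g" "gdist v z = k"
    using gdist_parent v g by (metis Diff_iff)
  have "gdist v w + gdist w z \<noteq> gdist v z" if "w \<in> Q" for w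
    using min[OF that] k z(3) by simp
  then have "v \<rightarrow>\<^sup>*\<^bsub>G \<restriction> (verts G - Q)\<^esub> z" using v z by (intro reachable_avoiding) auto
  then show ?thesis using z that by blast
qed

lemma max_clique_nonempty:
  assumes "max_clique Q"
  shows "Q \<noteq> {}"
proof -
  have "verts G \<noteq> {}" using connected by (simp add: connected_conv)
  then show ?thesis using assms by (auto simp: max_clique_def)
qed

text \<open>A nearest vertex of \<open>Q\<close> is the gate. The other distances exceed it by at
  most one, and a tie would attach one component to two vertices of \<open>Q\<close>.\<close>

lemma gate_exists:
  assumes Q: "max_clique Q" and v: "v \<in> verts G"
  obtains g where "is_gate Q v g"
proof (cases "v \<in> Q")
  case True
  then have "is_gate Q v v"
    using Q by (auto simp: is_gate_def max_clique_def clique_def gdist_adj)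
  then show ?thesis by (rule that)
next
  case False
  have QV: "Q \<subseteq> verts G" and cl: "clique Q" using Q by (auto simp: max_clique_def clique_def)
  obtain g where g: "g \<in> Q" and min: "\<And>q. q \<in> Q \<Longrightarrow> gdist v g \<le> gdist v q"
    using max_clique_nonempty[OF Q] ex_has_least_nat[of "\<lambda>q. q \<in> Q" _ "gdist v"]
    by (metis all_not_in_conv)
  have "gdist v q = Suc (gdist v g)" if q: "q \<in> Q" "q \<noteq> g" for q
  proof -
    have "gdist v q \<noteq> gdist v g"
    proof
      assume eq: "gdist v q = gdist v g"
      obtain z where z: "v \<rightarrow>\<^sup>*\<^bsub>G \<restriction> (verts G - Q)\<^esub> z" "z \<rightarrow>\<^bsub>G\<^esub> g"
        using nearest_attachment[of v Q g] v False g QV min by auto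
      obtain z' where z': "v \<rightarrow>\<^sup>*\<^bsub>G \<restriction> (verts G - Q)\<^esub> z'" "z' \<rightarrow>\<^bsub>G\<^esub> q"
        using nearest_attachment[of v Q q] v False q QV min eq by auto
      have "z \<rightarrow>\<^sup>*\<^bsub>G \<restriction> (verts G - Q)\<^esub> z'"
        using z z' reachable_induce_sym reachable_induce_trans by blast
      then show False using max_clique_attachment_unique[OF Q] g q z z' by blast
    qed
    moreover have "gdist v q \<le> gdist v g + 1"
      using gdist_triangle[of v g q] v g q QV cl gdist_adj[of g q] by (auto simp: clique_def)
    ultimately show ?thesis using min[OF q(1)] by simp
  qed
  then show ?thesis using g that by (auto simp: is_gate_def)
qed

lemma gate_le: "is_gate Q v g \<Longrightarrow> q \<in> Q \<Longrightarrow> gdist v g \<le> gdist v q"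
  unfolding is_gate_def by (cases "q = g") auto

text \<open>The route through both gates gives the upper bound. For the lower bound, a geodesic
  missing \<open>Q\<close> would put \<open>x\<close> and \<open>y\<close> into one component
  attached at both \<open>g\<close> and \<open>h\<close>.\<close>

lemma gdist_distinct_gates:
  assumes Q: "max_clique Q" and x: "x \<in> verts G" "y \<in> verts G"
    and g: "is_gate Q x g" "is_gate Q y h" "g \<noteq> h"
  shows "gdist x y = gdist x g + 1 + gdist h y"
proof -
  have QV: "Q \<subseteq> verts G" and cl: "clique Q" using Q by (auto simp: max_clique_def clique_def)
  have gQ: "g \<in> Q" "h \<in> Q" using g by (auto simp: is_gate_def)
  then have gV: "g \<in> verts G" "h \<in> verts G" using QV by auto
  have gh: "gdist g h = 1" using gQ g(3) cl by (auto simp: clique_def gdist_adj)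
  have "gdist x y \<le> gdist x g + 1 + gdist h y"
    using gdist_triangle[of x g y] gdist_triangle[of g h y] x gV gh by simp
  moreover have "gdist x g + 1 + gdist h y \<le> gdist x y"
  proof (cases "\<exists>w\<in>Q. gdist x w + gdist w y = gdist x y")
    case True
    then obtain w where w: "w \<in> Q" "gdist x w + gdist w y = gdist x y" by blast
    \<comment> \<open>If the geodesic meets \<open>Q\<close> at \<open>g\<close>, the extra step is
      paid on the side of \<open>y\<close>, whose gate is \<open>h\<close>; at any other
      \<open>w\<close> it is paid on the side of \<open>x\<close>.\<close>
    show ?thesis
    proof (cases "w = g")
      case True
      then show ?thesis using w g by (auto simp: is_gate_def gdist_sym)
    next
      case False
      then have "gdist x w = Suc (gdist x g)" using w g by (auto simp: is_gate_def)
      then show ?thesis using w gate_le[OF g(2) w(1)] by (simp add: gdist_sym)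
    qed
  next
    case False
    then have xy: "x \<rightarrow>\<^sup>*\<^bsub>G \<restriction> (verts G - Q)\<^esub> y" using x by (intro reachable_avoiding) auto
    then have out: "x \<in> verts G - Q" "y \<in> verts G - Q" by (auto elim: reachable_in_vertsE)
    obtain z where z: "x \<rightarrow>\<^sup>*\<^bsub>G \<restriction> (verts G - Q)\<^esub> z" "z \<rightarrow>\<^bsub>G\<^esub> g"
      using nearest_attachment[OF out(1) gQ(1) gV(1)] gate_le[OF g(1)] by blast
    obtain z' where z': "y \<rightarrow>\<^sup>*\<^bsub>G \<restriction> (verts G - Q)\<^esub> z'" "z' \<rightarrow>\<^bsub>G\<^esub> h"
      using nearest_attachment[OF out(2) gQ(2) gV(2)] gate_le[OF g(2)] by blast
    have "z \<rightarrow>\<^sup>*\<^bsub>G \<restriction> (verts G - Q)\<^esub> z'"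
      using z z' xy reachable_induce_sym reachable_induce_trans by blast
    then have "g = h" using max_clique_attachment_unique[OF Q] gQ z z' by blast
    then show ?thesis using g(3) by simp
  qed
  ultimately show ?thesis by simp
qed

text \<open>A vertex adjacent to all of \<open>W\<close> could be added to it, and the induced
  subgraph would be a larger complete one.\<close>

lemma max_clique_verts:
  assumes "maximal_clique G W"
  shows "max_clique (verts W)"
proof -
  have W: "subgraph W G" "complete_graph W"
    and max: "\<And>H. H \<noteq> W \<Longrightarrow> subgraph W H \<Longrightarrow> subgraph H G \<Longrightarrow> \<not> complete_graph H"
    using assms by (auto simp: maximal_clique_def max_subgraph_def)
  have cl: "clique (verts W)" using W by (rule complete_subgraph_clique)
  have "\<exists>q\<in>verts W. \<not> v \<rightarrow>\<^bsub>G\<^esub> q" if v: "v \<in> verts G - verts W" for v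
  proof (rule ccontr)
    let ?T = "insert v (verts W)"
    assume "\<not> ?thesis"
    then have "clique ?T" using cl v adj_sym by (auto simp: clique_def)
    then have TV: "?T \<subseteq> verts G" and "complete_graph (G \<restriction> ?T)"
      using complete_graph_induce_iff by (auto simp: clique_def)
    moreover have "subgraph (G \<restriction> ?T) G" using TV by (rule subgraph_induce_subgraphI)
    moreover have "wf_digraph W" "arcs W \<subseteq> arcs G" "compatible G W" using W(1) by auto
    then have "arcs W \<subseteq> arcs (G \<restriction> ?T)"
      using wf_digraph.wellformed[of W] by (auto simp: compatible_def)
    then have "subgraph W (G \<restriction> ?T)"
      using \<open>wf_digraph W\<close> \<open>compatible G W\<close> by (intro subgraphI) (auto simp: compatible_def)
    moreover have "G \<restriction> ?T \<noteq> W"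
    proof
      assume "G \<restriction> ?T = W"
      then have "?T = verts W" by (metis induce_subgraph_verts)
      then show False using v by blast
    qed
    ultimately show False using max by blast
  qed
  then show ?thesis using cl by (simp add: max_clique_def)
qed

lemma clique_extends:
  assumes "clique B"
  obtains W where "maximal_clique G W" "B \<subseteq> verts W"
proof -
  have B: "B \<subseteq> verts G" using assms by (simp add: clique_def)
  then have "subgraph (G \<restriction> B) G" "complete_graph (G \<restriction> B)"
    using assms by (auto simp: complete_graph_induce_iff subgraph_induce_subgraphI)
  then obtain W where "max_subgraph complete_graph W" "subgraph (G \<restriction> B) W"
    by (rule subgraph_extends_to_max_subgraph)
  then show ?thesis using that subgraph_imp_subverts by (fastforce simp: maximal_clique_def)
qed

section \<open>Maximal visibility sets\<close>

text \<open>A vertex with two nonadjacent neighbours lies between them and hides them from each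
  other. Conversely, a simplicial vertex is never strictly between two others, since its neighbours
  on a geodesic would provide a shortcut.\<close>

lemma total_mutual_visibility_set_iff:
  "total_mutual_visibility_set G X \<longleftrightarrow> X \<subseteq> {v. simplicial G v}"
proof -
  have nbh: "neighborhood G v \<subseteq> verts G" for v
    by (auto simp: neighborhood_def dest: adj_in_verts)
  have simp_iff: "simplicial G v \<longleftrightarrow> v \<in> verts G \<and> clique (neighborhood G v)" for v
    by (simp add: simplicial_def complete_graph_induce_iff[OF nbh])
  show ?thesis
  proof
    assume X: "total_mutual_visibility_set G X"
    then have XV: "X \<subseteq> verts G" by (simp add: total_mutual_visibility_set_def)
    have adj: "a \<rightarrow>\<^bsub>G\<^esub> b" if v: "v \<in> X" and ab: "v \<rightarrow>\<^bsub>G\<^esub> a" "v \<rightarrow>\<^bsub>G\<^esub> b" "a \<noteq> b" for v a b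
    proof (rule ccontr)
      assume nadj: "\<not> a \<rightarrow>\<^bsub>G\<^esub> b"
      have V: "v \<in> verts G" "a \<in> verts G" "b \<in> verts G" using ab by (auto dest: adj_in_verts)
      have d: "gdist a v = 1" "gdist v b = 1" using adj_sym[OF ab(1)] ab(2) by (simp_all add: gdist_adj)
      have "gdist a b \<le> 2" using gdist_triangle[OF V(2,1,3)] d by simp
      moreover have "gdist a b \<noteq> 0" "gdist a b \<noteq> 1"
        using ab(3) nadj gdist_eq_0_iff[OF V(2,3)] gdist_eq_1_iff[OF V(2,3)] by blast+
      ultimately have "gdist a v + gdist v b = gdist a b" using d by linarith
      moreover have "visible G X a b"
        using X V ab(3) by (simp add: total_mutual_visibility_set_def)
      ultimately have "v = a \<or> v = b" using visible_iff[OF V(2,3) XV] v by blast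
      then show False using ab adj_not_same by blast
    qed
    show "X \<subseteq> {v. simplicial G v}"
    proof
      fix v assume v: "v \<in> X"
      have "clique (neighborhood G v)"
        using nbh[of v] adj[OF v] unfolding clique_def neighborhood_def by blast
      then show "v \<in> {v. simplicial G v}" using v XV by (auto simp: simp_iff)
    qed
  next
    assume X: "X \<subseteq> {v. simplicial G v}"
    then have XV: "X \<subseteq> verts G" by (auto simp: simp_iff)
    have free: "x = a \<or> x = b"
      if V: "a \<in> verts G" "b \<in> verts G" and x: "x \<in> X"
        and between: "gdist a x + gdist x b = gdist a b" for a b x
    proof (rule ccontr)
      assume "\<not> ?thesis"
      then have ne: "x \<noteq> a" "x \<noteq> b" by auto
      have xV: "x \<in> verts G" using x XV by auto
      obtain k where k: "gdist a x = Suc k"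
        using ne V xV by (metis gdist_eq_0_iff not0_implies_Suc)
      obtain l where l: "gdist b x = Suc l"
        using ne V xV by (metis gdist_eq_0_iff not0_implies_Suc)
      obtain y where y: "y \<in> verts G" "y \<rightarrow>\<^bsub>G\<^esub> x" "gdist a y = k"
        using gdist_parent[OF V(1) xV k] by blast
      obtain z where z: "z \<in> verts G" "z \<rightarrow>\<^bsub>G\<^esub> x" "gdist b z = l"
        using gdist_parent[OF V(2) xV l] by blast
      have "clique (neighborhood G x)" using X x simp_iff by blast
      \<comment> \<open>Going from \<open>y\<close> to \<open>z\<close> directly costs at most one,
        while the detour through \<open>x\<close> costs two.\<close>
      then have "y \<noteq> z \<Longrightarrow> y \<rightarrow>\<^bsub>G\<^esub> z"
        using adj_sym[OF y(2)] adj_sym[OF z(2)] by (simp add: clique_def neighborhood_def)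
      then have "gdist y z \<le> 1" by (cases "y = z") (simp_all add: gdist_adj)
      moreover have "gdist a b \<le> gdist a y + (gdist y z + gdist z b)"
        using gdist_triangle[OF V(1) y(1) V(2)] gdist_triangle[OF y(1) z(1) V(2)] by simp
      moreover have "gdist z b = l" "gdist x b = Suc l"
        using z(3) l gdist_sym[of z b] gdist_sym[of x b] by simp_all
      ultimately show False using between k y(3) by simp
    qed
    have "visible G X a b" if V: "a \<in> verts G" "b \<in> verts G" for a b
      using free[OF V] visible_iff[OF V XV] by blast
    then show "total_mutual_visibility_set G X"
      using XV by (simp add: total_mutual_visibility_set_def)
  qed
qed

text \<open>The sets in question are all the subsets of one set, so that set is the only maximal
  one.\<close>

lemma lower_total_mutual_visibility_number_eq:
  "lower_total_mutual_visibility_number G = card {v. simplicial G v}"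
proof -
  have "{X. maximal_set (total_mutual_visibility_set G) X} = {{v. simplicial G v}}"
    unfolding maximal_set_def total_mutual_visibility_set_iff by blast
  then show ?thesis by (simp add: lower_total_mutual_visibility_number_def)
qed

section \<open>Mutual-visibility sets\<close>

lemma mutual_visibility_set_iff:
  "mutual_visibility_set G X \<longleftrightarrow> X \<subseteq> verts G \<and>
     (\<forall>a\<in>X. \<forall>b\<in>X. \<forall>x\<in>X. a \<noteq> b \<longrightarrow> gdist a x + gdist x b = gdist a b \<longrightarrow> x = a \<or> x = b)"
proof (cases "X \<subseteq> verts G")
  case True
  then have "visible G X a b \<longleftrightarrow> (\<forall>x\<in>X. gdist a x + gdist x b = gdist a b \<longrightarrow> x = a \<or> x = b)"
    if "a \<in> X" "b \<in> X" for a b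
    using that by (intro visible_iff) auto
  then show ?thesis using True unfolding mutual_visibility_set_def by blast
qed (simp add: mutual_visibility_set_def)

text \<open>Connectedness gives every vertex a neighbour, so a single vertex is not a maximal
  clique.\<close>

lemma max_clique_card_ge_2:
  assumes "card (verts G) \<ge> 2" and Q: "max_clique Q"
  shows "card Q \<ge> 2"
proof -
  obtain v where v: "v \<in> Q" using max_clique_nonempty[OF Q] by blast
  have QV: "Q \<subseteq> verts G" using Q by (auto simp: max_clique_def clique_def)
  then have fin: "finite Q" using finite_verts finite_subset by blast
  have "Q \<noteq> {v}"
  proof
    assume Qv: "Q = {v}"
    have "verts G \<noteq> {v}" using assms(1) by auto
    then obtain w where w: "w \<in> verts G" "w \<noteq> v" using v QV by blast
    obtain k where "gdist w v = Suc k"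
      using w v QV by (metis gdist_eq_0_iff not0_implies_Suc subsetD)
    then obtain z where z: "z \<in> verts G" "z \<rightarrow>\<^bsub>G\<^esub> v"
      using gdist_parent[of w v k] w v QV by blast
    then have "z \<in> verts G - Q" using Qv adj_not_same by auto
    then show False using Q z Qv by (auto simp: max_clique_def)
  qed
  then have "{v} \<subset> Q" using v by blast
  then have "card {v} < card Q" using fin by (intro psubset_card_mono)
  then show ?thesis by simp
qed

text \<open>All distances in \<open>Q\<close> are one, so nothing in \<open>Q\<close> lies between
  two of its members. For a further \<open>y\<close>, its gate lies strictly between
  \<open>y\<close> and any other vertex of \<open>Q\<close>.\<close>

lemma max_clique_maximal_mutual_visibility:
  assumes "card (verts G) \<ge> 2" and Q: "max_clique Q"
  shows "maximal_set (mutual_visibility_set G) Q"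
  unfolding maximal_set_def
proof (intro conjI allI impI notI)
  have cl: "clique Q" and QV: "Q \<subseteq> verts G" using Q by (auto simp: max_clique_def clique_def)
  have one: "gdist a b = 1" if "a \<in> Q" "b \<in> Q" "a \<noteq> b" for a b
    using that cl by (auto simp: clique_def gdist_adj)
  show "mutual_visibility_set G Q"
    unfolding mutual_visibility_set_iff
  proof (intro conjI ballI impI QV)
    fix a b x assume abx: "a \<in> Q" "b \<in> Q" "x \<in> Q" "a \<noteq> b" "gdist a x + gdist x b = gdist a b"
    show "x = a \<or> x = b"
    proof (rule ccontr)
      assume "\<not> ?thesis"
      then have "gdist a x = 1" "gdist x b = 1" "gdist a b = 1" using abx one by auto
      then show False using abx(5) by simp
    qed
  qed
  fix Y assume "Q \<subset> Y" and Y: "mutual_visibility_set G Y"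
  then obtain y where y: "y \<in> Y" "y \<notin> Q" and sub: "Q \<subseteq> Y" by blast
  have yV: "y \<in> verts G" using y Y by (auto simp: mutual_visibility_set_def)
  obtain g where g: "is_gate Q y g" using gate_exists[OF Q yV] .
  have "Q \<noteq> {g}" using max_clique_card_ge_2[OF assms] by auto
  then obtain w where w: "w \<in> Q" "w \<noteq> g" using g by (auto simp: is_gate_def)
  have gQ: "g \<in> Q" and "gdist y w = Suc (gdist y g)" using g w by (auto simp: is_gate_def)
  then have "gdist y g + gdist g w = gdist y w" using one[OF gQ w(1)] w by simp
  moreover have "y \<in> Y" "w \<in> Y" "g \<in> Y" "y \<noteq> w" using y w gQ sub by auto
  ultimately have "g = y \<or> g = w" using Y unfolding mutual_visibility_set_iff by blast
  then show False using gQ y w by blast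
qed

text \<open>
  The members \<open>x0\<close> and \<open>x1\<close> of \<open>X\<close> have different gates in \<open>Q\<close>, so a vertex of \<open>Q\<close> that is not the
  gate of any member of \<open>X\<close> could be added to \<open>X\<close>.
\<close>
lemma maximal_mutual_visibility_card_ge:
  assumes two: "card (verts G) \<ge> 2" and X: "maximal_set (mutual_visibility_set G) X"
  obtains W where "maximal_clique G W" "card (verts W) \<le> card X"
proof -
  have mv: "mutual_visibility_set G X"
    and max: "\<And>Y. X \<subset> Y \<Longrightarrow> \<not> mutual_visibility_set G Y"
    using X by (auto simp: maximal_set_def)
  have XV: "X \<subseteq> verts G" using mv by (simp add: mutual_visibility_set_def)
  then have finX: "finite X" using finite_verts finite_subset by blast
  have free: "x = a \<or> x = b"
    if "a \<in> X" "b \<in> X" "x \<in> X" "a \<noteq> b" "gdist a x + gdist x b = gdist a b" for a b x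
    using that mv unfolding mutual_visibility_set_iff by blast
  \<comment> \<open>A set with at most one member is not maximal, because any two vertices form a
    mutual-visibility set.\<close>
  obtain x0 x1 where x01: "x0 \<in> X" "x1 \<in> X" "x0 \<noteq> x1"
  proof (rule ccontr)
    assume "\<not> thesis"
    then have le1: "\<And>x y. x \<in> X \<Longrightarrow> y \<in> X \<Longrightarrow> x = y" using that by blast
    obtain u v where uv: "u \<in> verts G" "v \<in> verts G" "u \<noteq> v" "X \<subseteq> {u}"
    proof (cases "X = {}")
      case True
      have "\<not> card (verts G) \<le> Suc 0" using two by simp
      then show ?thesis using that True finite_verts by (auto simp: card_le_Suc0_iff_eq)
    next
      case False
      then obtain u where u: "X = {u}" using le1 by blast
      have "verts G \<noteq> {u}" using two by auto
      then show ?thesis using that u XV by blast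
    qed
    then have "mutual_visibility_set G {u, v}" by (auto simp: mutual_visibility_set_iff)
    moreover have "X \<subset> {u, v}" using uv by blast
    ultimately show False using max by blast
  qed
  then have x01V: "x0 \<in> verts G" "x1 \<in> verts G" using XV by auto
  obtain k where k: "gdist x0 x1 = Suc k"
    using x01 x01V by (metis gdist_eq_0_iff not0_implies_Suc)
  then obtain z where z: "z \<in> verts G" "z \<rightarrow>\<^bsub>G\<^esub> x1" "gdist x0 z = k"
    using gdist_parent[OF x01V k] by blast
  have "z \<noteq> x1" using z adj_not_same by blast
  have "clique {z, x1}" using z x01V adj_sym[OF z(2)] by (simp add: clique_def)
  \<comment> \<open>The clique is grown from the last edge of a geodesic from \<open>x0\<close> to
    \<open>x1\<close>; the presence of \<open>z\<close> keeps \<open>x1\<close> from being the gate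
    of \<open>x0\<close>.\<close>
  then obtain W where W: "maximal_clique G W" "{z, x1} \<subseteq> verts W" by (rule clique_extends)
  define Q where "Q = verts W"
  have Q: "max_clique Q" using W max_clique_verts by (simp add: Q_def)
  have cl: "clique Q" and QV: "Q \<subseteq> verts G" using Q by (auto simp: max_clique_def clique_def)
  define gate where "gate v = (SOME g. is_gate Q v g)" for v
  have gate: "is_gate Q v (gate v)" if "v \<in> verts G" for v
    unfolding gate_def using gate_exists[OF Q that] by (metis someI)
  have gateQ: "gate v \<in> Q" if "v \<in> verts G" for v using gate[OF that] by (simp add: is_gate_def)
  have gate_dist: "gdist v q = Suc (gdist v (gate v))" if "v \<in> verts G" "q \<in> Q" "q \<noteq> gate v" for v q
    using gate[OF that(1)] that by (simp add: is_gate_def)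
  have gate_self: "gate q = q" if "q \<in> Q" for q
    using gate_dist[of q q] that subsetD[OF QV that] by force
  have gates01: "gate x0 \<noteq> gate x1"
  proof
    assume "gate x0 = gate x1"
    then have "gate x0 = x1" using gate_self W(2) by (simp add: Q_def)
    then have "gdist x0 z = Suc (gdist x0 x1)"
      using gate_dist[OF x01V(1), of z] W(2) \<open>z \<noteq> x1\<close> by (simp add: Q_def)
    then show False using z k by simp
  qed
  have "Q \<subseteq> gate ` X"
  proof (rule ccontr)
    assume "\<not> ?thesis"
    then obtain q where q: "q \<in> Q" "q \<notin> gate ` X" by blast
    have qV: "q \<in> verts G" using q QV by blast
    have qX: "q \<notin> X" using q gate_self by force
    \<comment> \<open>Since \<open>q\<close> is nobody's gate, every member of \<open>X\<close>
      reaches it one step after its own gate.\<close>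
    have dq: "gdist x q = Suc (gdist x (gate x))" "gdist q x = Suc (gdist x (gate x))"
      if "x \<in> X" for x
    proof -
      show "gdist x q = Suc (gdist x (gate x))" using gate_dist[of x q] that XV q by blast
      then show "gdist q x = Suc (gdist x (gate x))" using gdist_sym[of q x] by simp
    qed
    \<comment> \<open>A route through \<open>q\<close> spends two steps between the gates of
      \<open>a\<close> and \<open>b\<close>, which are at distance at most one.\<close>
    have q_not_between: "gdist a q + gdist q b \<noteq> gdist a b" if ab: "a \<in> X" "b \<in> X" for a b
    proof -
      have V: "a \<in> verts G" "b \<in> verts G" using ab XV by auto
      have gV: "gate a \<in> verts G" "gate b \<in> verts G" using gateQ V QV by auto
      have "gdist (gate a) (gate b) \<le> 1"
        using gateQ[OF V(1)] gateQ[OF V(2)] cl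
        by (cases "gate a = gate b") (simp_all add: clique_def gdist_adj)
      moreover have "gdist a b \<le> gdist a (gate a) + (gdist (gate a) (gate b) + gdist (gate b) b)"
        using gdist_triangle[OF V(1) gV(1) V(2)] gdist_triangle[OF gV V(2)] by simp
      ultimately show ?thesis using dq ab gdist_sym[of "gate b" b] by simp
    qed
    have no_blocker: "x = b" if xb: "x \<in> X" "b \<in> X" and between: "gdist q x + gdist x b = gdist q b"
      for x b
    proof (rule ccontr)
      assume ne: "x \<noteq> b"
      have V: "x \<in> verts G" "b \<in> verts G" using xb XV by auto
      have gV: "gate x \<in> verts G" "gate b \<in> verts G" using gateQ V QV by auto
      have eq: "gdist x (gate x) + gdist x b = gdist b (gate b)" using between dq xb by simp
      have "gdist b (gate x) \<le> gdist b x + gdist x (gate x)"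
        using gdist_triangle[OF V(2,1) gV(1)] .
      then have "gdist b (gate x) \<le> gdist b (gate b)" using eq gdist_sym[of b x] by simp
      \<comment> \<open>Any vertex of \<open>Q\<close> other than the gate of \<open>b\<close> would
        be strictly farther from \<open>b\<close>.\<close>
      then have same: "gate x = gate b" using gate_dist[OF V(2) gateQ[OF V(1)]] by fastforce
      \<comment> \<open>One of \<open>x0\<close> and \<open>x1\<close> has a gate different from
        that of \<open>b\<close>. Seen from this \<open>y\<close>, the vertex \<open>x\<close>
        blocks \<open>b\<close> just as it does from \<open>q\<close>, which contradicts the mutual
        visibility of \<open>X\<close>.\<close>
      obtain y where y: "y \<in> X" "gate y \<noteq> gate b" using x01 gates01 by metis
      have yV: "y \<in> verts G" using y XV by auto
      have "gdist y x = gdist y (gate y) + 1 + gdist (gate x) x"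
        using gdist_distinct_gates[OF Q yV V(1) gate[OF yV] gate[OF V(1)]] y same by simp
      moreover have "gdist y b = gdist y (gate y) + 1 + gdist (gate b) b"
        using gdist_distinct_gates[OF Q yV V(2) gate[OF yV] gate[OF V(2)]] y by simp
      ultimately have "gdist y x + gdist x b = gdist y b"
        using eq gdist_sym[of "gate x" x] gdist_sym[of "gate b" b] by simp
      moreover have "y \<noteq> b" "x \<noteq> y" using y same by auto
      ultimately show False using free[OF y(1) xb(2,1)] ne by blast
    qed
    have "mutual_visibility_set G (insert q X)"
      unfolding mutual_visibility_set_iff
    proof (intro conjI ballI impI)
      show "insert q X \<subseteq> verts G" using qV XV by blast
      fix a b x assume abx: "a \<in> insert q X" "b \<in> insert q X" "x \<in> insert q X" "a \<noteq> b"
        and between: "gdist a x + gdist x b = gdist a b"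
      \<comment> \<open>By symmetry of the distance, the case \<open>b = q\<close> reduces to the
        case \<open>a = q\<close>.\<close>
      have flip: "gdist b x + gdist x a = gdist b a"
        using between gdist_sym[of a x] gdist_sym[of x b] gdist_sym[of a b] by simp
      show "x = a \<or> x = b"
      proof (cases "a = q \<or> b = q")
        case True
        then show ?thesis using abx between flip no_blocker by blast
      next
        case False
        then show ?thesis using abx between q_not_between free by blast
      qed
    qed
    moreover have "X \<subset> insert q X" using qX by blast
    ultimately show False using max by blast
  qed
  then have "card Q \<le> card X" using finX by (meson card_image_le card_mono finite_imageI le_trans)
  then show ?thesis using that W by (simp add: Q_def)
qed

end

theorem theorem5p1:
  fixes G W :: "('a, 'b) pre_digraph" and S :: "'a set"
  assumes "graph G"
    and "Digraph_Component.connected G"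
    and "block_graph G"
    and "card (verts G) \<ge> 2"
    and "S = {v. simplicial G v}"
    and "maximal_clique G W"
    and "\<And>W'. maximal_clique G W' \<Longrightarrow> card (verts W) \<le> card (verts W')"
  shows "lower_total_mutual_visibility_number G = card S \<and>
    lower_mutual_visibility_number G = card (verts W)"
proof
  interpret graph G by fact
  interpret connected_block_graph G
    by unfold_locales (use assms in auto)
  show "lower_total_mutual_visibility_number G = card S"
    using lower_total_mutual_visibility_number_eq assms(5) by simp
  let ?M = "{X. maximal_set (mutual_visibility_set G) X}"
  have "?M \<subseteq> Pow (verts G)" by (auto simp: maximal_set_def mutual_visibility_set_def)
  then have "finite (card ` ?M)" using finite_verts by (meson finite_Pow_iff finite_imageI finite_subset)
  \<comment> \<open>The minimum is attained at \<open>W\<close> itself; every other maximal set is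
    at least as large as some maximal clique, hence as \<open>W\<close>.\<close>
  moreover have "card (verts W) \<in> card ` ?M"
    using max_clique_maximal_mutual_visibility[OF assms(4) max_clique_verts[OF assms(6)]] by blast
  moreover have "card (verts W) \<le> n" if "n \<in> card ` ?M" for n
    using that maximal_mutual_visibility_card_ge[OF assms(4)] assms(7) by (metis imageE le_trans mem_Collect_eq)
  ultimately show "lower_mutual_visibility_number G = card (verts W)"
    unfolding lower_mutual_visibility_number_def by (intro Min_eqI) auto
qed

end
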